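(* For all integers $t\ge 0$ and $n\ge 1$, the following identity of rational functions in $x$ holds: $$\overline{N}^{(t)}_{n+1}(x)=\frac{a_0+a_1x+a_2x^2}{(n+t+1)(n+3)(c_0+c_1x)}\,\overline{N}^{(t)}_{n}(x)-\frac{n(n+t)(x-1)^2(b_0+b_1x)}{(n+t+1)(n+3)(c_0+c_1x)}\,\overline{N}^{(t)}_{n-1}(x),$$ where $$\begin{aligned} a_0&=-(2n+3)(n+t)(n+t+1),\\ a_1&=\tfrac{3}{2}t(t-2)(t+1)^2+t(t-2)(t^2+7t+5)n+3t(t-2)(t+2)n^2+2t(t-2)n^3,\\ a_2&=\tfrac12 t^2(t-1)(t+1)^2+(t-1)(2t^3+3t^2+t-3)n+(t-1)(3t^2+3t-5)n^2+2(t-1)^2n^3,\\ b_0&=-n-1-t,\\ b_1&=(t-1)^2n+\tfrac12(t-1)t^2+(t-1)^2,\\ c_0&=-n-t,\\ c_1&=(t-1)^2n+\tfrac12(t-1)t^2. \end{aligned}$$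
   Context: For nonnegative integers $n,m$ let $$N_{n,m}(x)=\sum_{k=0}^{n}\left(\binom{n}{k}\binom{m}{k}-\binom{n}{k+1}\binom{m}{k-1}\right)x^k,$$ where $\binom{a}{b}=0$ if $b<0$ or $b>a$. For nonnegative integers $t$ and $n$, put $\overline{N}^{(t)}_n(x)=N_{n+t,n}(x)$. *)

theory Defs
  imports "HOL-Computational_Algebra.Computational_Algebra"
begin

(* The lower index is an integer because k - 1 can be negative; "choose" on nat
   already vanishes when the lower index exceeds the upper one. *)
definition binom :: "nat \<Rightarrow> int \<Rightarrow> int" where
  "binom a b = (if b < 0 then 0 else int (a choose nat b))"

definition narayana_poly :: "nat \<Rightarrow> nat \<Rightarrow> rat poly" where
  "narayana_poly n m =
     (\<Sum>k=0..n. monom (of_int (binom n (int k) * binom m (int k)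
                               - binom n (int k + 1) * binom m (int k - 1))) k)"

definition narayana_bar :: "nat \<Rightarrow> nat \<Rightarrow> rat poly" where
  "narayana_bar t n = narayana_poly (n + t) n"

(* The coefficients take rational arguments so that subtraction does not truncate. *)

definition coef_a0 :: "rat \<Rightarrow> rat \<Rightarrow> rat" where
  "coef_a0 t n = - (2*n + 3) * (n + t) * (n + t + 1)"

definition coef_a1 :: "rat \<Rightarrow> rat \<Rightarrow> rat" where
  "coef_a1 t n = 3/2 * t * (t - 2) * (t + 1)^2
     + t * (t - 2) * (t^2 + 7*t + 5) * n
     + 3 * t * (t - 2) * (t + 2) * n^2
     + 2 * t * (t - 2) * n^3"

definition coef_a2 :: "rat \<Rightarrow> rat \<Rightarrow> rat" where
  "coef_a2 t n = 1/2 * t^2 * (t - 1) * (t + 1)^2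
     + (t - 1) * (2*t^3 + 3*t^2 + t - 3) * n
     + (t - 1) * (3*t^2 + 3*t - 5) * n^2
     + 2 * (t - 1)^2 * n^3"

definition coef_b0 :: "rat \<Rightarrow> rat \<Rightarrow> rat" where
  "coef_b0 t n = - n - 1 - t"

definition coef_b1 :: "rat \<Rightarrow> rat \<Rightarrow> rat" where
  "coef_b1 t n = (t - 1)^2 * n + 1/2 * (t - 1) * t^2 + (t - 1)^2"

definition coef_c0 :: "rat \<Rightarrow> rat \<Rightarrow> rat" where
  "coef_c0 t n = - n - t"

definition coef_c1 :: "rat \<Rightarrow> rat \<Rightarrow> rat" where
  "coef_c1 t n = (t - 1)^2 * n + 1/2 * (t - 1) * t^2"

definition rec_denom :: "nat \<Rightarrow> nat \<Rightarrow> rat poly" where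
  "rec_denom t n = of_nat ((n + t + 1) * (n + 3)) *
     [:coef_c0 (of_nat t) (of_nat n), coef_c1 (of_nat t) (of_nat n):]"

(* Since Fract p 0 = 0, this is what makes the fractions over rec_denom genuine. *)
lemma rec_denom_nonzero:
  assumes "n \<ge> 1"
  shows "rec_denom t n \<noteq> 0"
proof -
  have "(of_nat (n + t) :: rat) \<noteq> 0"
    using assms by (simp only: of_nat_eq_0_iff)
  then have "coef_c0 (of_nat t) (of_nat n) \<noteq> 0"
    by (simp add: coef_c0_def)
  moreover have "(of_nat ((n + t + 1) * (n + 3)) :: rat poly) \<noteq> 0"
    by (simp only: of_nat_eq_0_iff) simp
  ultimately show ?thesis
    unfolding rec_denom_def by (metis mult_eq_0_iff pCons_eq_0_iff)
qed

end

theory Submission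
  imports Defs
begin

text \<open>
  With the convention \<open>1/j! = 0\<close> for \<open>j < 0\<close>, the rule \<open>1/(j-1)! = j * 1/j!\<close> holds for every
  integer \<open>j\<close>, and the coefficient of \<open>x^k\<close> is the hypergeometric term
  \<open>(n+t)! n! (n + 1 - t k) / (k! (k+1)! (n+t-k)! (n+1-k)!)\<close> with no boundary cases. After clearing
  the denominator and comparing coefficients of \<open>x^k\<close>, all nine terms are polynomial multiples of
  \<open>(n+t)! n! / (k! (k+1)! (n+t+2-k)! (n+3-k)!)\<close>, so the recurrence reduces to one polynomial
  identity in \<open>t\<close>, \<open>n\<close>, \<open>k\<close>.
\<close>

text \<open>These are the values of 1/Gamma(j+1) at integers \<open>j\<close>; an integer argument
  lets index shifts go below zero without truncation.\<close>

definition inv_fact :: "int \<Rightarrow> rat" where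
  "inv_fact j = (if j < 0 then 0 else inverse (fact (nat j)))"

lemma inv_fact_neg: "j < 0 \<Longrightarrow> inv_fact j = 0"
  by (simp add: inv_fact_def)

text \<open>At \<open>j = 0\<close> the left side is zero by convention and the right side by its
  factor \<open>j\<close>, so the rule needs no side condition.\<close>

lemma inv_fact_diff_one: "inv_fact (j - 1) = of_int j * inv_fact j"
proof (cases "j \<le> 0")
  case False
  then obtain m where "j = int (Suc m)"
    by (metis not_le zero_less_imp_eq_int gr0_implies_Suc)
  moreover have "fact (Suc m) = (of_nat (Suc m) :: rat) * fact m" by simp
  moreover have "nat (int (Suc m) - 1) = m" by simp
  ultimately show ?thesis
    by (simp add: inv_fact_def del: fact_Suc of_nat_Suc)
qed (auto simp: inv_fact_def)

text \<open>For \<open>b\<close> outside the range from 0 to \<open>a\<close>, one of the two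
  reciprocal factorials vanishes, in agreement with \<open>binom\<close>.\<close>

lemma of_int_binom:
  "of_int (binom a b) = fact a * inv_fact b * inv_fact (int a - b)"
proof -
  consider "b < 0" | "b > int a" | "0 \<le> b" "b \<le> int a" by linarith
  then show ?thesis
  proof cases
    case 3
    then obtain k where k: "b = int k" "k \<le> a"
      by (metis nonneg_int_cases zle_int)
    then show ?thesis
      by (simp add: binom_def inv_fact_def binomial_fact nat_diff_distrib' field_simps)
  qed (auto simp: binom_def inv_fact_def)
qed

definition narayana_coeff :: "nat \<Rightarrow> nat \<Rightarrow> int \<Rightarrow> rat" where
  "narayana_coeff t n k = fact (n + t) * fact n * (of_nat n + 1 - of_nat t * of_int k)
     * (inv_fact k * inv_fact (k + 1) * inv_fact (int n + int t - k) * inv_fact (int n + 1 - k))"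

lemma narayana_coeff_neg: "k < 0 \<Longrightarrow> narayana_coeff t n k = 0"
  by (simp add: narayana_coeff_def inv_fact_neg)

text \<open>Once the common reciprocal factorials are pulled out, what remains is (k+1)(n+1-k) -
  k(n+t-k) = n+1-tk.\<close>

lemma narayana_coeff_eq_binom:
  "of_int (binom (n + t) k * binom n k - binom (n + t) (k + 1) * binom n (k - 1))
     = narayana_coeff t n k"
proof -
  have s: "inv_fact k = (of_int k + 1) * inv_fact (k + 1)"
    "inv_fact (k - 1) = of_int k * inv_fact k"
    "inv_fact (int n - k) = (of_nat n + 1 - of_int k) * inv_fact (int n + 1 - k)"
    "inv_fact (int n - (k - 1)) = inv_fact (int n + 1 - k)"
    "inv_fact (int (n + t) - k) = inv_fact (int n + int t - k)"
    "inv_fact (int (n + t) - (k + 1)) = (of_nat n + of_nat t - of_int k) * inv_fact (int n + int t - k)"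
    using inv_fact_diff_one[of "k + 1"] inv_fact_diff_one[of k]
      inv_fact_diff_one[of "int n + 1 - k"] inv_fact_diff_one[of "int n + int t - k"]
    by (simp_all add: algebra_simps)
  show ?thesis
    unfolding narayana_coeff_def of_int_diff of_int_mult of_int_binom s(2-6) s(1)
    by algebra
qed

lemma coeff_narayana_bar: "coeff (narayana_bar t n) k = narayana_coeff t n (int k)"
proof -
  have "coeff (narayana_bar t n) k = (if k \<le> n + t then narayana_coeff t n (int k) else 0)"
    unfolding narayana_bar_def narayana_poly_def narayana_coeff_eq_binom
    by (simp add: coeff_sum)
  \<comment> \<open>Past the upper limit of the sum the factor 1/(n+t-k)! is zero, so the closed
    form gives every coefficient.\<close>
  moreover have "narayana_coeff t n (int k) = 0" if "\<not> k \<le> n + t"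
    using that by (simp add: narayana_coeff_def inv_fact_neg)
  ultimately show ?thesis by simp
qed

lemma coeff_monom_mult_narayana_bar:
  "coeff (monom c j * narayana_bar t n) k = c * narayana_coeff t n (int k - int j)"
  by (simp add: coeff_monom_mult coeff_narayana_bar narayana_coeff_neg of_nat_diff)

text \<open>Each bracket is a term of the recurrence divided by its common hypergeometric factor.
  The four weights in the last group are the coefficients of (x-1)^2 (b0 + b1 x).\<close>

lemma coef_polynomial_identity:
  fixes t n k :: rat
  defines "P \<equiv> n + t + 2 - k" and "Q \<equiv> n + 3 - k"
  shows "(n + t + 1) * (n + 3) * (n + t + 1) * (n + 1) *
      (coef_c0 t n * (P * Q * (n + 2 - t * k))
       + coef_c1 t n * (k * (k + 1) * (n + 2 - t * (k - 1)))) =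
      coef_a0 t n * (P * (P - 1) * Q * (Q - 1) * (n + 1 - t * k))
    + coef_a1 t n * (k * (k + 1) * P * Q * (n + 1 - t * (k - 1)))
    + coef_a2 t n * (k * k * (k + 1) * (k - 1) * (n + 1 - t * (k - 2)))
    - (coef_b0 t n * (P * (P - 1) * (P - 2) * Q * (Q - 1) * (Q - 2) * (n - t * k))
      + (coef_b1 t n - 2 * coef_b0 t n) * (k * (k + 1) * P * (P - 1) * Q * (Q - 1) * (n - t * (k - 1)))
      + (coef_b0 t n - 2 * coef_b1 t n) * (k * k * (k + 1) * (k - 1) * P * Q * (n - t * (k - 2)))
      + coef_b1 t n * (k * k * (k + 1) * (k - 1) * (k - 1) * (k - 2) * (n - t * (k - 3))))"
  unfolding P_def Q_def coef_a0_def coef_a1_def coef_a2_def coef_b0_def coef_b1_def coef_c0_def coef_c1_def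
  by algebra


lemma narayana_coeff_recurrence:
  fixes t n :: nat and k :: int
  assumes "n \<ge> 1"
  defines "T \<equiv> of_nat t" and "N \<equiv> of_nat n"
  shows "(N + T + 1) * (N + 3) *
      (coef_c0 T N * narayana_coeff t (n + 1) k + coef_c1 T N * narayana_coeff t (n + 1) (k - 1)) =
      coef_a0 T N * narayana_coeff t n k
    + coef_a1 T N * narayana_coeff t n (k - 1)
    + coef_a2 T N * narayana_coeff t n (k - 2)
    - N * (N + T) *
      (coef_b0 T N * narayana_coeff t (n - 1) k
      + (coef_b1 T N - 2 * coef_b0 T N) * narayana_coeff t (n - 1) (k - 1)
      + (coef_b0 T N - 2 * coef_b1 T N) * narayana_coeff t (n - 1) (k - 2)
      + coef_b1 T N * narayana_coeff t (n - 1) (k - 3))"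
proof -
  define K P Q :: rat
    where "K = of_int k" and "P = N + T + 2 - K" and "Q = N + 3 - K"
  define x y where "x = int n + int t + 2 - k" and "y = int n + 3 - k"
  \<comment> \<open>The reciprocal factorials split into \<open>W\<close>, which depends on the
    coefficient index alone, and \<open>V\<close>, which sees the degree parameter and the index
    only through their difference. \<open>V 0\<close> has the largest arguments, so all other values
    are polynomial multiples of it.\<close>
  define W where "W l = inv_fact l * inv_fact (l + 1)" for l
  define V where "V i = inv_fact (x - i) * inv_fact (y - i)" for i
  define F where "F = fact (n + t) * fact n * (W k * V 0)"
  have xy: "of_int x = P" "of_int y = Q"
    by (simp_all add: x_def y_def P_def Q_def N_def T_def K_def)
  have W_step: "W (l - 1) = of_int l * (of_int l + 1) * W l" for l
    using inv_fact_diff_one[of l] inv_fact_diff_one[of "l + 1"] by (simp add: W_def)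
  have V_step: "V (i + 1) = (P - of_int i) * (Q - of_int i) * V i" for i
    using inv_fact_diff_one[of "x - i"] inv_fact_diff_one[of "y - i"]
    by (simp add: V_def xy diff_diff_eq)
  have W: "W (k - 1) = K * (K + 1) * W k"
    "W (k - 2) = K * K * (K + 1) * (K - 1) * W k"
    "W (k - 3) = K * K * (K + 1) * (K - 1) * (K - 1) * (K - 2) * W k"
    using W_step[of k] W_step[of "k - 1"] W_step[of "k - 2"] by (simp_all add: K_def)
  have V: "V 1 = P * Q * V 0" "V 2 = P * (P - 1) * Q * (Q - 1) * V 0"
    "V 3 = P * (P - 1) * (P - 2) * Q * (Q - 1) * (Q - 2) * V 0"
    using V_step[of 0] V_step[of 1] V_step[of 2] by simp_all
  have u: "narayana_coeff t m l
      = fact (m + t) * fact m * (of_nat m + 1 - T * of_int l) * (W l * V i)"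
    if "int m - l = int n + 2 - k - i" for m l i
  proof -
    have "int m + int t - l = x - i" "int m + 1 - l = y - i"
      using that by (auto simp: x_def y_def)
    then show ?thesis by (simp add: narayana_coeff_def W_def V_def T_def)
  qed
  have fact_next: "fact (Suc (n + t)) = (N + T + 1) * fact (n + t)" "fact (Suc n) = (N + 1) * fact n"
    by (simp_all add: N_def T_def algebra_simps)
  \<comment> \<open>Here \<open>n \<ge> 1\<close> makes \<open>n - 1\<close> a true
    predecessor.\<close>
  obtain m where n: "n = Suc m"
    using assms by (cases n) auto
  have fact_prev: "(N + T) * fact (n - 1 + t) = fact (n + t)" "N * fact (n - 1) = fact n"
    by (simp_all add: N_def T_def n algebra_simps)
  have n_prev: "of_nat (n - 1) = N - 1"
    by (simp add: N_def n)
  have u_next: "narayana_coeff t (n + 1) k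
      = (N + T + 1) * (N + 1) * F * (P * Q * (N + 2 - T * K))"
    "narayana_coeff t (n + 1) (k - 1)
      = (N + T + 1) * (N + 1) * F * (K * (K + 1) * (N + 2 - T * (K - 1)))"
    by (simp_all add: u[of _ _ 1] u[of _ _ 0] fact_next W V F_def N_def K_def del: fact_Suc)
  have u_same: "narayana_coeff t n k = F * (P * (P - 1) * Q * (Q - 1) * (N + 1 - T * K))"
    "narayana_coeff t n (k - 1) = F * (K * (K + 1) * P * Q * (N + 1 - T * (K - 1)))"
    "narayana_coeff t n (k - 2) = F * (K * K * (K + 1) * (K - 1) * (N + 1 - T * (K - 2)))"
    by (simp_all add: u[of _ _ 2] u[of _ _ 1] u[of _ _ 0] W V F_def N_def K_def)
  \<comment> \<open>The prefactor \<open>N * (N + T)\<close> raises (n-1+t)! (n-1)! to (n+t)! n!,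
    which removes any division.\<close>
  have prev: "N * (N + T) * narayana_coeff t (n - 1) l
      = fact (n + t) * fact n * (N - T * of_int l) * (W l * V i)"
    if "int n - 1 - l = int n + 2 - k - i" for l i
  proof -
    have "int (n - 1) - l = int n + 2 - k - i" using that n by simp
    from u[OF this] show ?thesis
      unfolding n_prev fact_prev[symmetric] by simp
  qed
  have u_prev: "N * (N + T) * narayana_coeff t (n - 1) k
      = F * (P * (P - 1) * (P - 2) * Q * (Q - 1) * (Q - 2) * (N - T * K))"
    "N * (N + T) * narayana_coeff t (n - 1) (k - 1)
      = F * (K * (K + 1) * P * (P - 1) * Q * (Q - 1) * (N - T * (K - 1)))"
    "N * (N + T) * narayana_coeff t (n - 1) (k - 2)
      = F * (K * K * (K + 1) * (K - 1) * P * Q * (N - T * (K - 2)))"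
    "N * (N + T) * narayana_coeff t (n - 1) (k - 3)
      = F * (K * K * (K + 1) * (K - 1) * (K - 1) * (K - 2) * (N - T * (K - 3)))"
    using prev[of k 3] prev[of "k - 1" 2] prev[of "k - 2" 1] prev[of "k - 3" 0]
    by (simp_all add: W V F_def K_def)
  have "(N + T + 1) * (N + 3) *
      (coef_c0 T N * narayana_coeff t (n + 1) k + coef_c1 T N * narayana_coeff t (n + 1) (k - 1))
      = F * ((N + T + 1) * (N + 3) * (N + T + 1) * (N + 1) *
      (coef_c0 T N * (P * Q * (N + 2 - T * K))
       + coef_c1 T N * (K * (K + 1) * (N + 2 - T * (K - 1)))))"
    unfolding u_next by algebra
  then show ?thesis
    unfolding coef_polynomial_identity[of N T K, folded P_def Q_def] u_same
    using u_prev by algebra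
qed

text \<open>Passes from the recurrence with cleared denominator, an identity of polynomials, to the
  fraction field.\<close>

lemma Fract_eq_of_mult_eq:
  fixes a b d p q r :: "'a::idom"
  assumes "d \<noteq> 0" and "d * p = a * q - b * r"
  shows "Fract p 1 = Fract a d * Fract q 1 - Fract b d * Fract r 1"
proof -
  have "Fract a d * Fract q 1 - Fract b d * Fract r 1 = Fract (d * (d * p)) (d * d)"
    using assms(1) by (simp add: assms(2) algebra_simps)
  also have "\<dots> = Fract p 1"
    using assms(1) by (simp add: eq_fract)
  finally show ?thesis ..
qed

theorem theorem4p1:
  fixes t n :: nat
  assumes "n \<ge> 1"
  shows "Fraction_Field.Fract (narayana_bar t (n + 1)) 1 =
      Fraction_Field.Fract
        [:coef_a0 (of_nat t) (of_nat n), coef_a1 (of_nat t) (of_nat n), coef_a2 (of_nat t) (of_nat n):]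
        (rec_denom t n)
        * Fraction_Field.Fract (narayana_bar t n) 1
    - Fraction_Field.Fract
        (of_nat (n * (n + t)) * [:-1, 1:]^2 * [:coef_b0 (of_nat t) (of_nat n), coef_b1 (of_nat t) (of_nat n):])
        (rec_denom t n)
        * Fraction_Field.Fract (narayana_bar t (n - 1)) 1"
    (is "_ = Fract ?A ?D * _ - Fract ?B ?D * _")
proof -
  define T N where "T = (of_nat t :: rat)" and "N = (of_nat n :: rat)"
  define D E where "D = (N + T + 1) * (N + 3)" and "E = N * (N + T)"
  \<comment> \<open>Written as sums of monomials, the three multipliers act on coefficients as
    weighted index shifts.\<close>
  have D: "?D = monom (D * coef_c0 T N) 0 + monom (D * coef_c1 T N) 1"
    by (simp add: rec_denom_def of_nat_poly T_def N_def D_def monom_altdef algebra_simps)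
  have A: "?A = monom (coef_a0 T N) 0 + monom (coef_a1 T N) 1 + monom (coef_a2 T N) 2"
    by (simp add: T_def N_def monom_altdef power2_eq_square)
  have B: "?B = monom (E * coef_b0 T N) 0 + monom (E * (coef_b1 T N - 2 * coef_b0 T N)) 1
      + monom (E * (coef_b0 T N - 2 * coef_b1 T N)) 2 + monom (E * coef_b1 T N) 3"
    by (simp add: T_def N_def E_def monom_altdef of_nat_poly power2_eq_square power3_eq_cube algebra_simps)
  have "?D * narayana_bar t (n + 1) = ?A * narayana_bar t n - ?B * narayana_bar t (n - 1)"
  proof (rule poly_eqI)
    fix k
    show "coeff (?D * narayana_bar t (n + 1)) k
        = coeff (?A * narayana_bar t n - ?B * narayana_bar t (n - 1)) k"
      using narayana_coeff_recurrence[OF assms, of t "int k", folded T_def N_def]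
      unfolding A B D distrib_right coeff_add coeff_diff coeff_monom_mult_narayana_bar D_def E_def
      by (simp add: algebra_simps)
  qed
  with rec_denom_nonzero[OF assms, of t] show ?thesis
    by (rule Fract_eq_of_mult_eq)
qed

end
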